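(* Let $n,k$ be integers with $1\le k\le n$. (i) If $\mathbf{p}$ is a non-degenerate probability distribution supported on $[a]=\{1,\ldots,a\}$, then $$d_{TV}(Y_{n,k}^{(\mathbf{p})},Z_{n,k})\le\binom n2\sum_{i=1}^ap_i^2.$$ When $\mathbf{p}$ is the uniform distribution over $[a]$, the bound can be improved to $$d_{TV}(Y_{n,k}^{(a)},Z_{n,k})\le1-\frac{a!}{(a-n)!}\frac1{a^n},\qquad a\ge n.$$ (ii) For any $z\in\mathbb{R}$ and $a\ge n\ge1$, $$\mathbb{P}(Y_{n,k}^{(a)}\ge z)\in\left[\mathbb{P}(Z_{n,k}\ge z),\ \mathbb{P}(Z_{n,k}\ge z)+1-\frac{a!}{(a-n)!}\frac1{a^n}\right].$$ (iii) For fixed $n$ and $k$, $Y_{n,k}^{(a)}\to Z_{n,k}$ in distribution as $a\to\infty$. (iv) The results in (i), (ii) and (iii) also hold when $Y_{n,k}^{(\mathbf{p})}$, $Y_{n,k}^{(a)}$ and $Z_{n,k}$ are replaced by $Y_n^{(\mathbf{p})}$, $Y_n^{(a)}$ and $Z_n$, respectively.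
   Context: $X_1,X_2,\ldots$ are i.i.d. random variables with $\mathbb{P}(X_1=j)=p_j$, $\mathbf{p}=(p_1,p_2,\ldots)$; non-degenerate means not concentrated at a single point. $Y_{n,k}^{(\mathbf{p})}=\sum_{1\le i_1<\cdots<i_k\le n}\mathbf{1}(X_{i_1}\le\cdots\le X_{i_k})$ is the number of weakly increasing subsequences of length $k$ of $X_1,\ldots,X_n$, with $Y_{n,0}^{(\mathbf{p})}=1$, and $Y_n^{(\mathbf{p})}=\sum_{k=0}^nY_{n,k}^{(\mathbf{p})}$. When $\mathbf{p}$ is uniform on $[a]$ these are written $Y_{n,k}^{(a)}$ and $Y_n^{(a)}$. $Z_{n,k}$ is the number of (strictly) increasing subsequences of length $k$ of a uniformly random permutation of $\{1,\ldots,n\}$ (with $Z_{n,0}=1$), and $Z_n=\sum_{k=0}^nZ_{n,k}$. $d_{TV}(U,V)=\sup_A|\mathbb{P}(U\in A)-\mathbb{P}(V\in A)|$ is the total variation distance between laws. *)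

theory Defs
  imports "HOL-Probability.Probability"
begin

text \<open>
  A subsequence of length \<open>k\<close>, i.e. a choice of positions \<open>1 \<le> i\<^sub>1 < \<dots> < i\<^sub>k \<le> n\<close>, is encoded by its
  \<open>k\<close>-element set of positions.  It is counted once per choice of positions, whether or not
  different choices give the same values.
\<close>

definition weak_incr_subseqs :: "nat \<Rightarrow> nat \<Rightarrow> (nat \<Rightarrow> nat) \<Rightarrow> nat" where
  "weak_incr_subseqs n k x = card {I. I \<subseteq> {1..n} \<and> card I = k \<and> mono_on I x}"

definition strict_incr_subseqs :: "nat \<Rightarrow> nat \<Rightarrow> (nat \<Rightarrow> nat) \<Rightarrow> nat" where
  "strict_incr_subseqs n k x = card {I. I \<subseteq> {1..n} \<and> card I = k \<and> strict_mono_on I x}"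

definition total_weak_incr_subseqs :: "nat \<Rightarrow> (nat \<Rightarrow> nat) \<Rightarrow> nat" where
  "total_weak_incr_subseqs n x = (\<Sum>k=0..n. weak_incr_subseqs n k x)"

definition total_strict_incr_subseqs :: "nat \<Rightarrow> (nat \<Rightarrow> nat) \<Rightarrow> nat" where
  "total_strict_incr_subseqs n x = (\<Sum>k=0..n. strict_incr_subseqs n k x)"

text \<open>
  \<open>iid_word n p\<close> is the law of \<open>(X\<^sub>1, \<dots>, X\<^sub>n)\<close> for i.i.d. \<open>X\<^sub>i\<close> with law \<open>p\<close>; coordinates outside
  \<open>{1..n}\<close> are set to the dummy value \<open>0\<close> and play no role.  The random variables \<open>Y\<close> and \<open>Z\<close> are
  represented by their laws; lemmas \<open>distr_weak_incr_subseqs\<close> and \<open>distr_total_weak_incr_subseqs\<close>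
  below show that \<open>Y_law\<close> and \<open>Y_total_law\<close> do not depend on how the \<open>X\<^sub>i\<close> are realised.
\<close>

definition iid_word :: "nat \<Rightarrow> nat pmf \<Rightarrow> (nat \<Rightarrow> nat) pmf" where
  "iid_word n p = Pi_pmf {1..n} 0 (\<lambda>_. p)"

definition uniform_perm :: "nat \<Rightarrow> (nat \<Rightarrow> nat) pmf" where
  "uniform_perm n = pmf_of_set {\<pi>. \<pi> permutes {1..n}}"

definition Y_law :: "nat \<Rightarrow> nat \<Rightarrow> nat pmf \<Rightarrow> nat pmf" where
  "Y_law n k p = map_pmf (weak_incr_subseqs n k) (iid_word n p)"

definition Y_total_law :: "nat \<Rightarrow> nat pmf \<Rightarrow> nat pmf" where
  "Y_total_law n p = map_pmf (total_weak_incr_subseqs n) (iid_word n p)"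

definition Z_law :: "nat \<Rightarrow> nat \<Rightarrow> nat pmf" where
  "Z_law n k = map_pmf (strict_incr_subseqs n k) (uniform_perm n)"

definition Z_total_law :: "nat \<Rightarrow> nat pmf" where
  "Z_total_law n = map_pmf (total_strict_incr_subseqs n) (uniform_perm n)"

text \<open>Only meaningful for \<open>a \<ge> 1\<close>.\<close>

definition unif :: "nat \<Rightarrow> nat pmf" where
  "unif a = pmf_of_set {1..a}"

definition nondegenerate :: "nat pmf \<Rightarrow> bool" where
  "nondegenerate p \<longleftrightarrow> \<not> (\<exists>j. set_pmf p = {j})"

definition d_TV :: "'a pmf \<Rightarrow> 'a pmf \<Rightarrow> real" where
  "d_TV p q = (SUP A. \<bar>measure_pmf.prob p A - measure_pmf.prob q A\<bar>)"

text \<open>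
  Convergence in distribution of \<open>nat\<close>-valued random variables, viewed as real-valued ones.
\<close>

definition converges_in_distribution :: "(nat \<Rightarrow> nat pmf) \<Rightarrow> nat pmf \<Rightarrow> bool" where
  "converges_in_distribution P q \<longleftrightarrow>
     weak_conv_m (\<lambda>a. distr (measure_pmf (P a)) borel real) (distr (measure_pmf q) borel real)"

lemma distr_iid_word:
  fixes X :: "nat \<Rightarrow> 'w \<Rightarrow> nat" and f :: "(nat \<Rightarrow> nat) \<Rightarrow> nat"
  assumes "prob_space M"
    and indep: "prob_space.indep_vars M (\<lambda>_. count_space UNIV) X {1..}"
    and law: "\<And>i. i \<ge> 1 \<Longrightarrow> distr M (count_space UNIV) (X i) = measure_pmf p"
    and f: "\<And>x y. (\<And>i. i \<in> {1..n} \<Longrightarrow> x i = y i) \<Longrightarrow> f x = f y"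
    and "n \<ge> 1"
  shows "distr M (count_space UNIV) (\<lambda>\<omega>. f (\<lambda>i. X i \<omega>)) = measure_pmf (map_pmf f (iid_word n p))"
proof -
  interpret prob_space M by fact
  let ?P = "PiM {1..n} (\<lambda>_. count_space (UNIV :: nat set))"
  have ne: "{1..n} \<noteq> {}" using \<open>n \<ge> 1\<close> by auto
  have P: "?P = count_space (PiE {1..n} (\<lambda>_. UNIV))"
    by (rule count_space_PiM_finite) auto
  have indep': "indep_vars (\<lambda>_. count_space UNIV) X {1..n}"
    by (rule indep_vars_subset[OF indep]) auto
  have rv: "random_variable (count_space UNIV) (X i)" if "i \<in> {1..n}" for i
    using indep' that by (auto simp: indep_vars_def)
  have fP: "f \<in> measurable ?P (count_space UNIV)"
    unfolding P by auto
  have mX: "(\<lambda>\<omega>. \<lambda>i\<in>{1..n}. X i \<omega>) \<in> measurable M ?P"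
    by (rule measurable_restrict) (use rv in auto)
  have "distr M ?P (\<lambda>\<omega>. \<lambda>i\<in>{1..n}. X i \<omega>) = PiM {1..n} (\<lambda>i. distr M (count_space UNIV) (X i))"
    using indep_vars_iff_distr_eq_PiM'[of "{1..n}" X "\<lambda>_. count_space UNIV"] ne rv indep' by blast
  also have "\<dots> = PiM {1..n} (\<lambda>_. measure_pmf p)"
    by (intro PiM_cong) (auto simp: law)
  finally have 1: "distr M ?P (\<lambda>\<omega>. \<lambda>i\<in>{1..n}. X i \<omega>) = PiM {1..n} (\<lambda>_. measure_pmf p)" .
  have "prob_space.indep_vars (measure_pmf (iid_word n p)) (\<lambda>_. count_space UNIV) (\<lambda>i x. x i) {1..n}"
    unfolding iid_word_def by (rule indep_vars_Pi_pmf) auto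
  then have "distr (measure_pmf (iid_word n p)) ?P (\<lambda>x. \<lambda>i\<in>{1..n}. x i)
      = PiM {1..n} (\<lambda>i. distr (measure_pmf (iid_word n p)) (count_space UNIV) (\<lambda>x. x i))"
    using prob_space.indep_vars_iff_distr_eq_PiM'[OF prob_space_measure_pmf[of "iid_word n p"],
        of "{1..n}" "\<lambda>i x. x i" "\<lambda>_. count_space UNIV"] ne by auto
  also have "\<dots> = PiM {1..n} (\<lambda>_. measure_pmf p)"
  proof (intro PiM_cong refl)
    fix i assume i: "i \<in> {1..n}"
    have "measure_pmf (map_pmf (\<lambda>x. x i) (iid_word n p)) = measure_pmf p"
      unfolding iid_word_def using i by (subst Pi_pmf_component) auto
    then show "distr (measure_pmf (iid_word n p)) (count_space UNIV) (\<lambda>x. x i) = measure_pmf p"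
      by (simp add: map_pmf_rep_eq)
  qed
  finally have 2: "distr (measure_pmf (iid_word n p)) ?P (\<lambda>x. \<lambda>i\<in>{1..n}. x i)
      = PiM {1..n} (\<lambda>_. measure_pmf p)" .
  have r: "f (restrict x {1..n}) = f x" for x
    by (rule f) auto
  have "distr M (count_space UNIV) (\<lambda>\<omega>. f (\<lambda>i. X i \<omega>))
      = distr (distr M ?P (\<lambda>\<omega>. \<lambda>i\<in>{1..n}. X i \<omega>)) (count_space UNIV) f"
    by (subst distr_distr[OF fP mX]) (simp only: o_def r)
  also have "\<dots> = distr (distr (measure_pmf (iid_word n p)) ?P (\<lambda>x. \<lambda>i\<in>{1..n}. x i))
      (count_space UNIV) f"
    unfolding 1 2 ..
  also have "\<dots> = distr (measure_pmf (iid_word n p)) (count_space UNIV) f"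
  proof (subst distr_distr[OF fP])
    show "(\<lambda>x. \<lambda>i\<in>{1..n}. x i) \<in> measurable (measure_pmf (iid_word n p)) ?P"
      unfolding P by auto
  qed (simp only: o_def r)
  finally show ?thesis by (simp add: map_pmf_rep_eq)
qed

lemma weak_incr_subseqs_cong:
  assumes "\<And>i. i \<in> {1..n} \<Longrightarrow> x i = y i"
  shows "weak_incr_subseqs n k x = weak_incr_subseqs n k y"
proof -
  have "mono_on I x \<longleftrightarrow> mono_on I y" if "I \<subseteq> {1..n}" for I
  proof -
    have "x i = y i" if "i \<in> I" for i using assms that \<open>I \<subseteq> {1..n}\<close> by blast
    then show ?thesis by (auto simp: monotone_on_def)
  qed
  then have "{I. I \<subseteq> {1..n} \<and> card I = k \<and> mono_on I x} = {I. I \<subseteq> {1..n} \<and> card I = k \<and> mono_on I y}"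
    by blast
  then show ?thesis by (simp add: weak_incr_subseqs_def)
qed

lemma distr_weak_incr_subseqs:
  fixes X :: "nat \<Rightarrow> 'w \<Rightarrow> nat"
  assumes "prob_space M"
    and "prob_space.indep_vars M (\<lambda>_. count_space UNIV) X {1..}"
    and "\<And>i. i \<ge> 1 \<Longrightarrow> distr M (count_space UNIV) (X i) = measure_pmf p"
    and "n \<ge> 1"
  shows "distr M (count_space UNIV) (\<lambda>\<omega>. weak_incr_subseqs n k (\<lambda>i. X i \<omega>)) = measure_pmf (Y_law n k p)"
  unfolding Y_law_def
  by (rule distr_iid_word[OF assms(1-3)]) (use assms(4) in \<open>auto intro: weak_incr_subseqs_cong\<close>)

lemma distr_total_weak_incr_subseqs:
  fixes X :: "nat \<Rightarrow> 'w \<Rightarrow> nat"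
  assumes "prob_space M"
    and "prob_space.indep_vars M (\<lambda>_. count_space UNIV) X {1..}"
    and "\<And>i. i \<ge> 1 \<Longrightarrow> distr M (count_space UNIV) (X i) = measure_pmf p"
    and "n \<ge> 1"
  shows "distr M (count_space UNIV) (\<lambda>\<omega>. total_weak_incr_subseqs n (\<lambda>i. X i \<omega>)) = measure_pmf (Y_total_law n p)"
  unfolding Y_total_law_def
  by (rule distr_iid_word[OF assms(1-3)])
     (use assms(4) in \<open>auto simp: total_weak_incr_subseqs_def intro!: sum.cong weak_incr_subseqs_cong\<close>)

end

theory Submission
  imports Defs
begin

text \<open>
  The law of the word and the law of the permutation are realised on one probability space so that
  the count for the word never falls below the count for the permutation and equals it whenever the
  letters are distinct.  Let \<open>x\<close> be an i.i.d. word, let \<open>s\<close> be a permutation that sorts \<open>x\<close>, and let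
  \<open>\<sigma>\<close> be a uniformly random permutation independent of \<open>x\<close>.  Put \<open>y = x \<circ> s\<close>, a weakly increasing
  word, and \<open>w = y \<circ> \<sigma>\<close>.  For fixed \<open>x\<close> the permutation \<open>s \<circ> \<sigma>\<close> is again uniform, and an i.i.d. word
  is exchangeable, so \<open>w\<close> is an i.i.d. word (\<open>word_permutation_coupling\<close>).

  As \<open>y\<close> is weakly increasing, positions along which \<open>\<sigma>\<close> increases are positions along which \<open>w\<close>
  weakly increases; the converse holds if \<open>w\<close> has no repeated letter.  Hence \<open>Y \<ge> Z\<close> on this space,
  which is the lower bound for the tails, and the total variation distance is at most the
  probability that \<open>w\<close> repeats a letter.  That is a birthday problem: a union bound over pairs of
  positions gives the collision bound \<open>(n choose 2) * (\<Sum>i. p\<^sub>i\<^sup>2)\<close>, and counting injective words gives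
  the exact value for the uniform law.  The upper bound for the tails and the convergence in
  distribution follow from the bounds on the total variation distance.

  Only these two comparisons between \<open>w\<close> and \<open>\<sigma>\<close> enter the argument, so it is carried out in
  \<open>approximation_by_permutation_statistic\<close> for an arbitrary pair of statistics; subsequences of a
  fixed length and subsequences of all lengths are two instances.
\<close>

section \<open>Total variation distance and couplings\<close>

lemma abs_prob_diff_le_d_TV:
  "\<bar>measure_pmf.prob P A - measure_pmf.prob Q A\<bar> \<le> d_TV P Q"
proof -
  have "\<bar>measure_pmf.prob P B - measure_pmf.prob Q B\<bar> \<le> 1" for B
    using measure_pmf.prob_le_1[of P B] measure_pmf.prob_le_1[of Q B]
      measure_nonneg[of P B] measure_nonneg[of Q B] by linarith
  then have "bdd_above (range (\<lambda>A. \<bar>measure_pmf.prob P A - measure_pmf.prob Q A\<bar>))"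
    by (intro bdd_aboveI[of _ 1]) auto
  then show ?thesis
    unfolding d_TV_def by (rule cSUP_upper2[OF _ UNIV_I order_refl])
qed

lemma d_TV_nonneg: "0 \<le> d_TV P Q"
  using abs_prob_diff_le_d_TV[of P UNIV Q] by simp

text \<open>
  The coupling inequality: outside the event \<open>u \<noteq> v\<close> both components of a coupling are in a given set
  or neither is.
\<close>

lemma d_TV_le_prob_neq:
  "d_TV (map_pmf fst C) (map_pmf snd C) \<le> measure_pmf.prob C {(u, v). u \<noteq> v}"
proof -
  let ?D = "{(u, v). u \<noteq> v}"
  have "\<bar>measure_pmf.prob (map_pmf fst C) A - measure_pmf.prob (map_pmf snd C) A\<bar>
      \<le> measure_pmf.prob C ?D" for A
  proof -
    have "measure_pmf.prob C (fst -` A) \<le> measure_pmf.prob C (snd -` A \<union> ?D)"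
      by (rule measure_pmf.finite_measure_mono) auto
    also have "\<dots> \<le> measure_pmf.prob C (snd -` A) + measure_pmf.prob C ?D"
      by (rule measure_subadditive) auto
    finally have 1: "measure_pmf.prob C (fst -` A) \<le> \<dots>" .
    have "measure_pmf.prob C (snd -` A) \<le> measure_pmf.prob C (fst -` A \<union> ?D)"
      by (rule measure_pmf.finite_measure_mono) auto
    also have "\<dots> \<le> measure_pmf.prob C (fst -` A) + measure_pmf.prob C ?D"
      by (rule measure_subadditive) auto
    finally have 2: "measure_pmf.prob C (snd -` A) \<le> \<dots>" .
    show ?thesis using 1 2 by simp
  qed
  then show ?thesis
    unfolding d_TV_def by (intro cSUP_least) auto
qed

lemma converges_in_distribution_if_d_TV_tendsto_0:
  assumes "(\<lambda>a. d_TV (P a) Q) \<longlonglongrightarrow> 0"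
  shows "converges_in_distribution P Q"
proof -
  have cdf: "cdf (distr (measure_pmf R) borel real) x = measure_pmf.prob R {y. real y \<le> x}"
    for R :: "nat pmf" and x
    by (simp add: cdf_def measure_distr vimage_def)
  have "(\<lambda>a. measure_pmf.prob (P a) A) \<longlonglongrightarrow> measure_pmf.prob Q A" for A
  proof -
    have "(\<lambda>a. measure_pmf.prob (P a) A - measure_pmf.prob Q A) \<longlonglongrightarrow> 0"
      by (rule tendsto_rabs_zero_cancel, rule tendsto_sandwich[OF _ _ tendsto_const assms])
        (auto simp: abs_prob_diff_le_d_TV)
    then show ?thesis by (rule LIM_zero_cancel)
  qed
  then show ?thesis
    unfolding converges_in_distribution_def weak_conv_m_def weak_conv_def cdf by simp
qed

section \<open>Coupling a word with a permutation\<close>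

lemma sorting_permutation:
  fixes x :: "nat \<Rightarrow> nat"
  obtains s where "s permutes {1..n}" and "mono_on {1..n} (x \<circ> s)"
proof -
  define ys where "ys = sort_key x [1..<Suc n]"
  define s where "s i = (if i \<in> {1..n} then ys ! (i - 1) else i)" for i
  have len: "length ys = n" and dist: "distinct ys" and set: "set ys = {1..n}"
    by (auto simp: ys_def)
  have "bij_betw (\<lambda>i. i - 1) {1..n} {..<n}"
    by (rule bij_betwI[where g = Suc]) auto
  moreover have "bij_betw ((!) ys) {..<n} {1..n}"
    by (rule bij_betw_nth) (simp_all add: len dist set)
  ultimately have "bij_betw ((!) ys \<circ> (\<lambda>i. i - 1)) {1..n} {1..n}"
    by (rule bij_betw_trans)
  then have "bij_betw s {1..n} {1..n}"
    by (rule bij_betw_cong[THEN iffD1, rotated]) (auto simp: s_def)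
  then have "s permutes {1..n}"
    by (rule bij_imp_permutes) (auto simp: s_def)
  moreover have "mono_on {1..n} (x \<circ> s)"
  proof (rule mono_onI)
    fix i j assume ij: "i \<in> {1..n}" "j \<in> {1..n}" "i \<le> j"
    have "sorted (map x ys)" by (simp add: ys_def)
    then have "map x ys ! (i - 1) \<le> map x ys ! (j - 1)"
      by (rule sorted_nth_mono) (use ij len in auto)
    then show "(x \<circ> s) i \<le> (x \<circ> s) j" using ij len by (auto simp: s_def)
  qed
  ultimately show ?thesis by (rule that)
qed

lemma set_uniform_perm: "set_pmf (uniform_perm n) = {\<sigma>. \<sigma> permutes {1..n}}"
proof -
  have "{\<sigma>. \<sigma> permutes {1..n}} \<noteq> {}" using permutes_id by blast
  then show ?thesis by (simp add: uniform_perm_def finite_permutations)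
qed

lemma uniform_perm_compose:
  assumes "s permutes {1..n}"
  shows "map_pmf (\<lambda>\<sigma>. s \<circ> \<sigma>) (uniform_perm n) = uniform_perm n"
  unfolding uniform_perm_def
proof (rule map_pmf_of_set_bij_betw)
  show "bij_betw (\<lambda>\<sigma>. s \<circ> \<sigma>) {\<sigma>. \<sigma> permutes {1..n}} {\<sigma>. \<sigma> permutes {1..n}}"
  proof (rule bij_betwI[where g = "\<lambda>\<sigma>. inv s \<circ> \<sigma>"])
    show "(\<lambda>\<sigma>. s \<circ> \<sigma>) \<in> {\<sigma>. \<sigma> permutes {1..n}} \<rightarrow> {\<sigma>. \<sigma> permutes {1..n}}"
      using assms by (auto intro: permutes_compose)
    show "(\<lambda>\<sigma>. inv s \<circ> \<sigma>) \<in> {\<sigma>. \<sigma> permutes {1..n}} \<rightarrow> {\<sigma>. \<sigma> permutes {1..n}}"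
      using assms by (auto intro: permutes_compose permutes_inv)
  qed (use permutes_inv_o[OF assms] in \<open>auto simp: o_assoc\<close>)
  show "{\<sigma>. \<sigma> permutes {1..n}} \<noteq> {}" using permutes_id by blast
qed (simp add: finite_permutations)

lemma iid_word_compose:
  assumes "\<sigma> permutes {1..n}"
  shows "map_pmf (\<lambda>x. x \<circ> \<sigma>) (iid_word n p) = iid_word n p"
  unfolding iid_word_def
  by (rule Pi_pmf_bij_betw[symmetric])
    (use assms permutes_imp_bij[OF assms] in \<open>auto simp: permutes_in_image permutes_not_in\<close>)

text \<open>
  The second component is independent of the word that gets sorted, but not of the first component
  \<open>w\<close>: it arranges the letters of \<open>w\<close>, in sorted order, into \<open>w\<close>.  In effect \<open>\<sigma>\<close> is the rank pattern
  of \<open>w\<close> with ties broken at random.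
\<close>

lemma word_permutation_coupling:
  obtains C where "map_pmf fst C = iid_word n p" and "map_pmf snd C = uniform_perm n"
    and "\<And>w \<sigma>. (w, \<sigma>) \<in> set_pmf C \<Longrightarrow>
           \<sigma> permutes {1..n} \<and> (\<exists>y. mono_on {1..n} y \<and> w = y \<circ> \<sigma>)"
proof -
  obtain s :: "(nat \<Rightarrow> nat) \<Rightarrow> nat \<Rightarrow> nat"
    where s: "\<And>x. s x permutes {1..n}" "\<And>x. mono_on {1..n} (x \<circ> s x)"
    by (metis sorting_permutation)
  let ?X = "iid_word n p" and ?U = "uniform_perm n"
  define C where "C = bind_pmf ?X (\<lambda>x. map_pmf (\<lambda>\<sigma>. (x \<circ> s x \<circ> \<sigma>, \<sigma>)) ?U)"
  have "map_pmf fst C = bind_pmf ?X (\<lambda>x. map_pmf (\<lambda>\<sigma>. x \<circ> \<sigma>) (map_pmf (\<lambda>\<sigma>. s x \<circ> \<sigma>) ?U))"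
    by (simp add: C_def map_bind_pmf pmf.map_comp o_def)
  \<comment> \<open>The sorting permutation depends on \<open>x\<close>, but for each fixed \<open>x\<close> uniformity absorbs it.\<close>
  also have "\<dots> = bind_pmf ?X (\<lambda>x. bind_pmf ?U (\<lambda>\<sigma>. return_pmf (x \<circ> \<sigma>)))"
    using s(1) by (simp only: uniform_perm_compose) (simp only: map_pmf_def)
  \<comment> \<open>Drawing \<open>\<sigma>\<close> first makes exchangeability of the word applicable.\<close>
  also have "\<dots> = bind_pmf ?U (\<lambda>\<sigma>. map_pmf (\<lambda>x. x \<circ> \<sigma>) ?X)"
    by (subst bind_commute_pmf) (simp add: map_pmf_def)
  also have "\<dots> = bind_pmf ?U (\<lambda>_. ?X)"
    by (rule bind_pmf_cong) (auto simp: set_uniform_perm iid_word_compose)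
  finally have "map_pmf fst C = ?X" by simp
  moreover have "map_pmf snd C = ?U"
    by (simp add: C_def map_bind_pmf pmf.map_comp o_def)
  moreover have "\<sigma> permutes {1..n} \<and> (\<exists>y. mono_on {1..n} y \<and> w = y \<circ> \<sigma>)"
    if "(w, \<sigma>) \<in> set_pmf C" for w \<sigma>
    using that s by (auto simp: C_def set_uniform_perm)
  ultimately show ?thesis by (rule that)
qed

section \<open>Repeated letters\<close>

text \<open>
  This is independence of two coordinates, in the form that reduces a collision at two positions to
  the diagonal of a product of two laws.
\<close>

lemma Pi_pmf_two_components:
  assumes "finite A" "i \<in> A" "j \<in> A" "i \<noteq> j"
  shows "map_pmf (\<lambda>x. (x i, x j)) (Pi_pmf A d p) = pair_pmf (p i) (p j)"
proof -
  have "Pi_pmf A d p = map_pmf (\<lambda>(y, f). f(i := y)) (pair_pmf (p i) (Pi_pmf (A - {i}) d p))"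
    using Pi_pmf_insert[of "A - {i}" i d p] assms by (simp add: insert_absorb)
  then have "map_pmf (\<lambda>x. (x i, x j)) (Pi_pmf A d p)
      = map_pmf ((\<lambda>x. (x i, x j)) \<circ> (\<lambda>(y, f). f(i := y)))
          (pair_pmf (p i) (Pi_pmf (A - {i}) d p))"
    by (simp only: pmf.map_comp)
  also have "\<dots> = map_pmf (map_prod id (\<lambda>f. f j)) (pair_pmf (p i) (Pi_pmf (A - {i}) d p))"
    using assms by (intro map_pmf_cong) auto
  also have "\<dots> = pair_pmf (map_pmf id (p i)) (map_pmf (\<lambda>f. f j) (Pi_pmf (A - {i}) d p))"
    by (simp only: map_pair map_prod_def id_def)
  also have "\<dots> = pair_pmf (p i) (p j)"
    using assms by (simp add: Pi_pmf_component)
  finally show ?thesis .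
qed

lemma prob_pair_pmf_diagonal:
  assumes "finite S" "set_pmf p \<subseteq> S"
  shows "measure_pmf.prob (pair_pmf p p) {(u, v). u = v} = (\<Sum>i\<in>S. (pmf p i)\<^sup>2)"
proof -
  have "measure_pmf.prob (pair_pmf p p) {(u, v). u = v}
      = measure_pmf.prob (pair_pmf p p) ((\<lambda>i. (i, i)) ` S)"
    by (rule measure_eq_AE) (use assms in \<open>auto simp: AE_measure_pmf_iff\<close>)
  also have "\<dots> = (\<Sum>z\<in>(\<lambda>i. (i, i)) ` S. pmf (pair_pmf p p) z)"
    using assms by (simp add: measure_measure_pmf_finite)
  also have "\<dots> = (\<Sum>i\<in>S. (pmf p i)\<^sup>2)"
    by (subst sum.reindex) (auto simp: inj_on_def pmf_pair power2_eq_square)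
  finally show ?thesis .
qed

text \<open>
  A word with a repeated letter already repeats it on some pair of positions.  Two given positions
  carry equal letters with probability \<open>\<Sum>i. p\<^sub>i\<^sup>2\<close>, and there are \<open>n choose 2\<close> pairs.
\<close>

lemma prob_not_inj_le:
  assumes "finite S" "set_pmf p \<subseteq> S"
  shows "measure_pmf.prob (iid_word n p) {x. \<not> inj_on x {1..n}}
    \<le> real (n choose 2) * (\<Sum>i\<in>S. (pmf p i)\<^sup>2)"
proof -
  let ?K = "{K. K \<subseteq> {1..n} \<and> card K = 2}"
  have "{x :: nat \<Rightarrow> nat. \<not> inj_on x {1..n}} \<subseteq> (\<Union>K\<in>?K. {x. \<not> inj_on x K})"
  proof
    fix x :: "nat \<Rightarrow> nat" assume "x \<in> {x. \<not> inj_on x {1..n}}"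
    then obtain i j where ij: "i \<in> {1..n}" "j \<in> {1..n}" "i \<noteq> j" "x i = x j"
      by (auto simp: inj_on_def)
    then have "{i, j} \<in> ?K" "\<not> inj_on x {i, j}" by (auto simp: inj_on_def)
    then show "x \<in> (\<Union>K\<in>?K. {x. \<not> inj_on x K})" by blast
  qed
  then have "measure_pmf.prob (iid_word n p) {x. \<not> inj_on x {1..n}}
      \<le> measure_pmf.prob (iid_word n p) (\<Union>K\<in>?K. {x. \<not> inj_on x K})"
    by (intro measure_pmf.finite_measure_mono) auto
  also have "\<dots> \<le> (\<Sum>K\<in>?K. measure_pmf.prob (iid_word n p) {x. \<not> inj_on x K})"
    by (rule measure_pmf.finite_measure_subadditive_finite) auto
  also have "\<dots> = (\<Sum>K\<in>?K. \<Sum>i\<in>S. (pmf p i)\<^sup>2)"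
  proof (rule sum.cong[OF refl])
    fix K assume "K \<in> ?K"
    then obtain i j where K: "K = {i, j}" "i \<noteq> j" "i \<in> {1..n}" "j \<in> {1..n}"
      by (auto simp: card_2_iff)
    have "measure_pmf.prob (iid_word n p) {x. \<not> inj_on x K}
        = measure_pmf.prob (map_pmf (\<lambda>x. (x i, x j)) (iid_word n p)) {(u, v). u = v}"
      using K by (auto simp: vimage_def inj_on_def intro!: arg_cong[where f = "measure_pmf.prob _"])
    also have "\<dots> = (\<Sum>i\<in>S. (pmf p i)\<^sup>2)"
      unfolding iid_word_def using K assms
      by (subst Pi_pmf_two_components) (auto simp: prob_pair_pmf_diagonal)
    finally show "measure_pmf.prob (iid_word n p) {x. \<not> inj_on x K} = (\<Sum>i\<in>S. (pmf p i)\<^sup>2)" .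
  qed
  also have "\<dots> = real (n choose 2) * (\<Sum>i\<in>S. (pmf p i)\<^sup>2)"
    by (simp add: n_subsets)
  finally show ?thesis .
qed

text \<open>
  All \<open>a ^ n\<close> words are equally likely, and \<open>a (a - 1) \<dots> (a - n + 1)\<close> of them are injective.
\<close>

lemma prob_not_inj_unif:
  assumes "1 \<le> n" "n \<le> a"
  shows "measure_pmf.prob (iid_word n (unif a)) {x. \<not> inj_on x {1..n}}
    = 1 - fact a / fact (a - n) * (1 / real a ^ n)"
proof -
  let ?W = "PiE_dflt {1..n} (0::nat) (\<lambda>_. {1..a})"
  let ?J = "{x. inj_on x {1..n}}"
  have iid: "iid_word n (unif a) = pmf_of_set ?W"
    unfolding iid_word_def unif_def using assms by (subst Pi_pmf_of_set) auto
  have W: "finite ?W" "?W \<noteq> {}" "card ?W = a ^ n"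
    using assms by (auto simp: card_PiE_dflt PiE_dflt_empty_iff)
  have "bij_betw (\<lambda>x. restrict x {1..n}) (?W \<inter> ?J)
      {f \<in> {1..n} \<rightarrow>\<^sub>E {1..a}. inj_on f {1..n}}"
  proof (rule bij_betw_imageI)
    show "inj_on (\<lambda>x. restrict x {1..n}) (?W \<inter> ?J)"
    proof (rule inj_onI, rule ext)
      fix x y :: "nat \<Rightarrow> nat" and i
      assume W: "x \<in> ?W \<inter> ?J" "y \<in> ?W \<inter> ?J" and eq: "restrict x {1..n} = restrict y {1..n}"
      show "x i = y i"
      proof (cases "i \<in> {1..n}")
        case True
        then show ?thesis using fun_cong[OF eq, of i] by (simp only: restrict_apply' if_True)
      next
        case False
        then have "x i = 0" "y i = 0" using W unfolding PiE_dflt_def by blast+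
        then show ?thesis by simp
      qed
    qed
    have "(\<lambda>x. restrict x {1..n}) ` (?W \<inter> ?J)
        = (\<lambda>x. restrict x {1..n}) ` ?W \<inter> {f. inj_on f {1..n}}"
      by (auto simp: inj_on_restrict_eq)
    then show "(\<lambda>x. restrict x {1..n}) ` (?W \<inter> ?J)
        = {f \<in> {1..n} \<rightarrow>\<^sub>E {1..a}. inj_on f {1..n}}"
      by (simp only: restrict_PiE_dflt) blast
  qed
  then have "card (?W \<inter> ?J) = card {f \<in> {1..n} \<rightarrow>\<^sub>E {1..a}. inj_on f {1..n}}"
    by (rule bij_betw_same_card)
  also have "\<dots> = (\<Prod>i = 0..<n. a - i)"
    by (subst card_inj_on_subset_funcset) auto
  finally have card: "card (?W \<inter> ?J) = (\<Prod>i = 0..<n. a - i)" .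
  have "n \<le> a \<Longrightarrow> fact a = real (\<Prod>i = 0..<n. a - i) * fact (a - n)" for n
  proof (induction n)
    case (Suc n)
    have "fact (a - n) = real (a - n) * fact (a - Suc n)"
      using Suc.prems by (subst fact_reduce) auto
    then show ?case using Suc by simp
  qed simp
  with assms have "real (card (?W \<inter> ?J)) = fact a / fact (a - n)"
    unfolding card by simp
  then have inj: "measure_pmf.prob (iid_word n (unif a)) ?J = fact a / fact (a - n) * (1 / real a ^ n)"
    unfolding iid measure_pmf_of_set[OF W(2,1)] W(3) by (simp only: of_nat_power times_divide_eq_right mult_1_right)
  have "{x :: nat \<Rightarrow> nat. \<not> inj_on x {1..n}} = space (measure_pmf (iid_word n (unif a))) - ?J"
    by auto
  then show ?thesis
    using measure_pmf.prob_compl[of ?J "iid_word n (unif a)"] inj by simp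
qed

section \<open>Increasing subsequences of coupled words\<close>

lemma strict_le_weak_incr_subseqs:
  assumes "\<sigma> permutes {1..n}" "mono_on {1..n} y"
  shows "strict_incr_subseqs n k \<sigma> \<le> weak_incr_subseqs n k (y \<circ> \<sigma>)"
  unfolding strict_incr_subseqs_def weak_incr_subseqs_def
proof (rule card_mono)
  have "mono_on I (y \<circ> \<sigma>)" if I: "I \<subseteq> {1..n}" "strict_mono_on I \<sigma>" for I
  proof (rule mono_onI)
    fix i j assume ij: "i \<in> I" "j \<in> I" "i \<le> j"
    have "\<sigma> i \<in> {1..n}" "\<sigma> j \<in> {1..n}"
      using ij I permutes_in_image[OF assms(1)] by blast+
    moreover have "\<sigma> i \<le> \<sigma> j"
      using I(2) ij by (auto intro: mono_onD[OF strict_mono_on_imp_mono_on])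
    ultimately show "(y \<circ> \<sigma>) i \<le> (y \<circ> \<sigma>) j"
      using mono_onD[OF assms(2), of "\<sigma> i" "\<sigma> j"] by simp
  qed
  then show "{I. I \<subseteq> {1..n} \<and> card I = k \<and> strict_mono_on I \<sigma>}
      \<subseteq> {I. I \<subseteq> {1..n} \<and> card I = k \<and> mono_on I (y \<circ> \<sigma>)}" by blast
qed simp

text \<open>
  If \<open>\<sigma>\<close> decreased between two positions along which \<open>y \<circ> \<sigma>\<close> weakly increases, monotonicity of \<open>y\<close>
  would force equal letters there.
\<close>

lemma weak_eq_strict_incr_subseqs:
  assumes "\<sigma> permutes {1..n}" "mono_on {1..n} y" "inj_on (y \<circ> \<sigma>) {1..n}"
  shows "weak_incr_subseqs n k (y \<circ> \<sigma>) = strict_incr_subseqs n k \<sigma>"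
proof (rule antisym)
  have "strict_mono_on I \<sigma>" if I: "I \<subseteq> {1..n}" "mono_on I (y \<circ> \<sigma>)" for I
  proof (rule strict_mono_onI, rule ccontr)
    fix i j assume ij: "i \<in> I" "j \<in> I" "i < j" "\<not> \<sigma> i < \<sigma> j"
    have "\<sigma> i \<in> {1..n}" "\<sigma> j \<in> {1..n}"
      using ij I permutes_in_image[OF assms(1)] by blast+
    then have "y (\<sigma> j) \<le> y (\<sigma> i)" using ij mono_onD[OF assms(2), of "\<sigma> j" "\<sigma> i"] by simp
    moreover have "y (\<sigma> i) \<le> y (\<sigma> j)" using ij mono_onD[OF I(2), of i j] by simp
    ultimately have "i = j" using ij(1,2) I(1) inj_onD[OF assms(3), of i j] by fastforce
    then show False using ij by simp
  qed
  then show "weak_incr_subseqs n k (y \<circ> \<sigma>) \<le> strict_incr_subseqs n k \<sigma>"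
    unfolding strict_incr_subseqs_def weak_incr_subseqs_def by (intro card_mono) auto
qed (rule strict_le_weak_incr_subseqs[OF assms(1,2)])

text \<open>
  Here \<open>f\<close> is a statistic of words and \<open>g\<close> one of permutations.  The hypotheses compare them on the
  coupled pair \<open>(y \<circ> \<sigma>, \<sigma>)\<close>: the inequality gives stochastic domination, and the equality bounds the
  total variation distance by the probability of a repeated letter.
\<close>

lemma approximation_by_permutation_statistic:
  fixes f g :: "(nat \<Rightarrow> nat) \<Rightarrow> nat"
  assumes n: "1 \<le> n"
    and le: "\<And>\<sigma> y. \<sigma> permutes {1..n} \<Longrightarrow> mono_on {1..n} y \<Longrightarrow> g \<sigma> \<le> f (y \<circ> \<sigma>)"
    and eq: "\<And>\<sigma> y. \<sigma> permutes {1..n} \<Longrightarrow> mono_on {1..n} y \<Longrightarrow> inj_on (y \<circ> \<sigma>) {1..n} \<Longrightarrow>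
      f (y \<circ> \<sigma>) = g \<sigma>"
  defines "Y \<equiv> \<lambda>p. map_pmf f (iid_word n p)" and "Z \<equiv> map_pmf g (uniform_perm n)"
  shows "\<And>p a. set_pmf p \<subseteq> {1..a} \<Longrightarrow>
      d_TV (Y p) Z \<le> real (n choose 2) * (\<Sum>i=1..a. (pmf p i)\<^sup>2)"
    and "\<And>a. n \<le> a \<Longrightarrow>
      d_TV (Y (unif a)) Z \<le> 1 - fact a / fact (a - n) * (1 / real a ^ n)"
    and "\<And>a z. n \<le> a \<Longrightarrow>
      measure_pmf.prob (Y (unif a)) {y. real y \<ge> z} \<in>
        {measure_pmf.prob Z {y. real y \<ge> z} ..
         measure_pmf.prob Z {y. real y \<ge> z} + 1 - fact a / fact (a - n) * (1 / real a ^ n)}"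
    and "converges_in_distribution (\<lambda>a. Y (unif a)) Z"
proof -
  have coupled: "d_TV (Y p) Z \<le> measure_pmf.prob (iid_word n p) {x. \<not> inj_on x {1..n}} \<and>
      measure_pmf.prob Z {y. real y \<ge> z} \<le> measure_pmf.prob (Y p) {y. real y \<ge> z}" for p z
  proof -
    obtain C where C: "map_pmf fst C = iid_word n p" "map_pmf snd C = uniform_perm n"
      "\<And>w \<sigma>. (w, \<sigma>) \<in> set_pmf C \<Longrightarrow>
         \<sigma> permutes {1..n} \<and> (\<exists>y. mono_on {1..n} y \<and> w = y \<circ> \<sigma>)"
      by (rule word_permutation_coupling[of n p]) blast
    define D where "D = map_pmf (map_prod f g) C"
    have Y: "Y p = map_pmf fst D" and Z: "Z = map_pmf snd D"
      by (simp_all add: Y_def Z_def D_def flip: C(1,2) add: pmf.map_comp o_def map_prod_def case_prod_unfold)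
    have ae_le: "g \<sigma> \<le> f w" if "(w, \<sigma>) \<in> set_pmf C" for w \<sigma>
      using C(3)[OF that] le by blast
    have ae_eq: "\<not> inj_on w {1..n}" if "(w, \<sigma>) \<in> set_pmf C" "f w \<noteq> g \<sigma>" for w \<sigma>
      using C(3)[OF that(1)] that(2) eq by blast
    have "d_TV (Y p) Z \<le> measure_pmf.prob D {(u, v). u \<noteq> v}"
      unfolding Y Z by (rule d_TV_le_prob_neq)
    also have "\<dots> = measure_pmf.prob C {(w, \<sigma>). f w \<noteq> g \<sigma>}"
      by (simp add: D_def vimage_def case_prod_unfold)
    also have "\<dots> \<le> measure_pmf.prob C {(w, \<sigma>). \<not> inj_on w {1..n}}"
      using ae_eq by (intro measure_pmf.finite_measure_mono_AE) (auto simp: AE_measure_pmf_iff)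
    also have "\<dots> = measure_pmf.prob (iid_word n p) {x. \<not> inj_on x {1..n}}"
      by (simp add: vimage_def case_prod_unfold flip: C(1))
    finally have 1: "d_TV (Y p) Z \<le> \<dots>" .
    have "measure_pmf.prob C {(w, \<sigma>). real (g \<sigma>) \<ge> z} \<le> measure_pmf.prob C {(w, \<sigma>). real (f w) \<ge> z}"
      using ae_le by (intro measure_pmf.finite_measure_mono_AE)
        (auto simp: AE_measure_pmf_iff intro: order_trans)
    then have 2: "measure_pmf.prob Z {y. real y \<ge> z} \<le> measure_pmf.prob (Y p) {y. real y \<ge> z}"
      by (simp add: Y Z D_def vimage_def case_prod_unfold)
    from 1 2 show ?thesis ..
  qed
  show i: "d_TV (Y p) Z \<le> real (n choose 2) * (\<Sum>i=1..a. (pmf p i)\<^sup>2)"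
    if "set_pmf p \<subseteq> {1..a}" for p a
    using coupled[of p] prob_not_inj_le[OF _ that, of n] by (meson finite_atLeastAtMost order_trans)
  show ii: "d_TV (Y (unif a)) Z \<le> 1 - fact a / fact (a - n) * (1 / real a ^ n)" if "n \<le> a" for a
    using coupled[of "unif a"] prob_not_inj_unif[OF n that] by simp
  show "measure_pmf.prob (Y (unif a)) {y. real y \<ge> z} \<in>
      {measure_pmf.prob Z {y. real y \<ge> z} ..
       measure_pmf.prob Z {y. real y \<ge> z} + 1 - fact a / fact (a - n) * (1 / real a ^ n)}"
    if "n \<le> a" for z a
    using coupled[of "unif a" z] ii[OF that]
      abs_prob_diff_le_d_TV[of "Y (unif a)" "{y. real y \<ge> z}" Z] by auto
  \<comment> \<open>The collision bound for the uniform law is \<open>(n choose 2) / a\<close>, which gives the limit without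
    any asymptotics for factorials.\<close>
  have "d_TV (Y (unif a)) Z \<le> real (n choose 2) / real a" if "1 \<le> a" for a
  proof -
    have "pmf (unif a) i = 1 / real a" if "i \<in> {1..a}" for i
      using that \<open>1 \<le> a\<close> by (simp add: unif_def)
    then have "(\<Sum>i=1..a. (pmf (unif a) i)\<^sup>2) = 1 / real a"
      using that by (simp add: power2_eq_square)
    moreover have "set_pmf (unif a) \<subseteq> {1..a}" using that by (simp add: unif_def)
    ultimately show ?thesis using i[of "unif a" a] by simp
  qed
  then have upper: "eventually (\<lambda>a. d_TV (Y (unif a)) Z \<le> real (n choose 2) / real a) sequentially"
    using eventually_sequentially by blast
  have lim: "(\<lambda>a. real (n choose 2) / real a) \<longlonglongrightarrow> 0"
    by (rule lim_const_over_n)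
  have "(\<lambda>a. d_TV (Y (unif a)) Z) \<longlonglongrightarrow> 0"
    by (rule tendsto_sandwich[OF _ upper tendsto_const lim]) (simp add: d_TV_nonneg)
  then show "converges_in_distribution (\<lambda>a. Y (unif a)) Z"
    by (rule converges_in_distribution_if_d_TV_tendsto_0)
qed

theorem theorem7p1:
  fixes n k :: nat
  assumes "1 \<le> k" and "k \<le> n"
  shows
    "((\<forall>(a::nat) (p::nat pmf). nondegenerate p \<and> set_pmf p \<subseteq> {1..a} \<longrightarrow>
          d_TV (Y_law n k p) (Z_law n k) \<le> real (n choose 2) * (\<Sum>i=1..a. (pmf p i)\<^sup>2)) \<and>
      (\<forall>a::nat. a \<ge> n \<longrightarrow>
          d_TV (Y_law n k (unif a)) (Z_law n k) \<le> 1 - fact a / fact (a - n) * (1 / real a ^ n)) \<and>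
      (\<forall>(z::real) (a::nat). a \<ge> n \<longrightarrow>
          measure_pmf.prob (Y_law n k (unif a)) {y. real y \<ge> z} \<in>
            {measure_pmf.prob (Z_law n k) {y. real y \<ge> z} ..
             measure_pmf.prob (Z_law n k) {y. real y \<ge> z} + 1 - fact a / fact (a - n) * (1 / real a ^ n)}) \<and>
      converges_in_distribution (\<lambda>a. Y_law n k (unif a)) (Z_law n k)) \<and>
     ((\<forall>(a::nat) (p::nat pmf). nondegenerate p \<and> set_pmf p \<subseteq> {1..a} \<longrightarrow>
          d_TV (Y_total_law n p) (Z_total_law n) \<le> real (n choose 2) * (\<Sum>i=1..a. (pmf p i)\<^sup>2)) \<and>
      (\<forall>a::nat. a \<ge> n \<longrightarrow>
          d_TV (Y_total_law n (unif a)) (Z_total_law n) \<le> 1 - fact a / fact (a - n) * (1 / real a ^ n)) \<and>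
      (\<forall>(z::real) (a::nat). a \<ge> n \<longrightarrow>
          measure_pmf.prob (Y_total_law n (unif a)) {y. real y \<ge> z} \<in>
            {measure_pmf.prob (Z_total_law n) {y. real y \<ge> z} ..
             measure_pmf.prob (Z_total_law n) {y. real y \<ge> z} + 1 - fact a / fact (a - n) * (1 / real a ^ n)}) \<and>
      converges_in_distribution (\<lambda>a. Y_total_law n (unif a)) (Z_total_law n))"
proof (rule conjI, goal_cases)
  case 1
  have n: "1 \<le> n" using assms by simp
  note approx = approximation_by_permutation_statistic[
      where f = "weak_incr_subseqs n k" and g = "strict_incr_subseqs n k",
      OF n strict_le_weak_incr_subseqs weak_eq_strict_incr_subseqs]
  show ?case
    unfolding Y_law_def Z_law_def using approx by blast
next
  case 2
  have n: "1 \<le> n" using assms by simp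
  have le: "total_strict_incr_subseqs n \<sigma> \<le> total_weak_incr_subseqs n (y \<circ> \<sigma>)"
    if "\<sigma> permutes {1..n}" "mono_on {1..n} y" for \<sigma> y
    unfolding total_strict_incr_subseqs_def total_weak_incr_subseqs_def
    by (intro sum_mono strict_le_weak_incr_subseqs that)
  have eq: "total_weak_incr_subseqs n (y \<circ> \<sigma>) = total_strict_incr_subseqs n \<sigma>"
    if "\<sigma> permutes {1..n}" "mono_on {1..n} y" "inj_on (y \<circ> \<sigma>) {1..n}" for \<sigma> y
    unfolding total_strict_incr_subseqs_def total_weak_incr_subseqs_def
    by (intro sum.cong refl weak_eq_strict_incr_subseqs that)
  note approx = approximation_by_permutation_statistic[
      where f = "total_weak_incr_subseqs n" and g = "total_strict_incr_subseqs n", OF n le eq]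
  show ?case
    unfolding Y_total_law_def Z_total_law_def using approx by blast
qed

end
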